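(* Let $R$ be a commutative ring and $M$ a nonzero $R$-module. (1) If $M$ is finitely generated, supplemented and every maximal hollow $R$-submodule of $M$ is second, then $M$ is second representable. (2) If $M$ is coatomic, every maximal $R$-submodule of $M$ has a supplement in $M$, every maximal hollow $R$-submodule of $M$ is second and $Att^s(M)$ is finite, then $M$ is second representable.
   Context: Let $R$ be a commutative ring and $M$ a nonzero $R$-module. A submodule $K\le M$ is second if $K\neq 0$ and for every ideal $I\le R$ we have $IK=K$ or $IK=0$. $Att^s(M):=\{(0:_RK)\mid K \text{ a second submodule of } M\}$, where $(0:_RK)=\{r\in R\mid rK=0\}$. $M$ is second representable if $M$ is a finite sum of second submodules. A submodule $N\le M$ is small in $M$ if $N+L\neq M$ for every proper submodule $L\lneq M$. A module is hollow if each of its proper submodules is small in it; a maximal hollow submodule of $M$ is one maximal with respect to inclusion among the hollow submodules of $M$. A supplement of a submodule $N\le M$ in $M$ is a submodule $L\le M$ minimal with respect to $N+L=M$. $M$ is supplemented if every submodule of $M$ has a supplement in $M$. $M$ is coatomic if every proper submodule of $M$ is contained in a maximal (proper) submodule of $M$. *)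

theory Defs
  imports "HOL-Algebra.Module" "HOL-Algebra.Ideal"
begin

text \<open>
  Conventions. A submodule \<open>K\<close> of \<open>M\<close> is a set with \<open>submodule K R M\<close>; regarded as a module in
  its own right it is \<open>M\<lparr>carrier := K\<rparr>\<close> (see \<open>submodule_is_module\<close>). The sum of two submodules is
  the library's \<open>N <+>\<^bsub>M\<^esub> L\<close>, and the zero submodule is \<open>{\<zero>\<^bsub>M\<^esub>}\<close>.
\<close>

text \<open>The product \<open>I K\<close>: all finite sums of products \<open>a k\<close> with \<open>a \<in> I\<close> and \<open>k \<in> K\<close>.\<close>

definition ideal_smult :: "('a, 'b, 'm) module_scheme \<Rightarrow> 'a set \<Rightarrow> 'b set \<Rightarrow> 'b set" where
  "ideal_smult M I K =
     {(\<Oplus>\<^bsub>M\<^esub>i\<in>{..<n}. a i \<odot>\<^bsub>M\<^esub> k i) | (n :: nat) a k.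
        a \<in> {..<n} \<rightarrow> I \<and> k \<in> {..<n} \<rightarrow> K}"

definition second_submodule ::
  "'b set \<Rightarrow> ('a, 'r) ring_scheme \<Rightarrow> ('a, 'b, 'm) module_scheme \<Rightarrow> bool" where
  "second_submodule K R M \<longleftrightarrow>
     submodule K R M \<and> K \<noteq> {\<zero>\<^bsub>M\<^esub>} \<and>
     (\<forall>I. ideal I R \<longrightarrow> ideal_smult M I K = K \<or> ideal_smult M I K = {\<zero>\<^bsub>M\<^esub>})"

definition annihilator ::
  "('a, 'r) ring_scheme \<Rightarrow> ('a, 'b, 'm) module_scheme \<Rightarrow> 'b set \<Rightarrow> 'a set" where
  "annihilator R M K = {r \<in> carrier R. \<forall>x\<in>K. r \<odot>\<^bsub>M\<^esub> x = \<zero>\<^bsub>M\<^esub>}"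

definition Att_s ::
  "('a, 'r) ring_scheme \<Rightarrow> ('a, 'b, 'm) module_scheme \<Rightarrow> 'a set set" where
  "Att_s R M = {annihilator R M K | K. second_submodule K R M}"

definition second_representable ::
  "('a, 'r) ring_scheme \<Rightarrow> ('a, 'b, 'm) module_scheme \<Rightarrow> bool" where
  "second_representable R M \<longleftrightarrow>
     (\<exists>(n :: nat) K. (\<forall>i<n. second_submodule (K i) R M) \<and>
        carrier M = {(\<Oplus>\<^bsub>M\<^esub>i\<in>{..<n}. x i) | x. x \<in> (\<Pi> i\<in>{..<n}. K i)})"

definition small_submodule ::
  "'b set \<Rightarrow> ('a, 'r) ring_scheme \<Rightarrow> ('a, 'b, 'm) module_scheme \<Rightarrow> bool" where
  "small_submodule N R M \<longleftrightarrow>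
     submodule N R M \<and>
     (\<forall>L. submodule L R M \<and> L \<noteq> carrier M \<longrightarrow> N <+>\<^bsub>M\<^esub> L \<noteq> carrier M)"

text \<open>The zero module is (vacuously) hollow under this definition.\<close>

definition hollow_module ::
  "('a, 'r) ring_scheme \<Rightarrow> ('a, 'b, 'm) module_scheme \<Rightarrow> bool" where
  "hollow_module R M \<longleftrightarrow>
     (\<forall>N. submodule N R M \<and> N \<noteq> carrier M \<longrightarrow> small_submodule N R M)"

definition hollow_submodule ::
  "'b set \<Rightarrow> ('a, 'r) ring_scheme \<Rightarrow> ('a, 'b, 'm) module_scheme \<Rightarrow> bool" where
  "hollow_submodule H R M \<longleftrightarrow> submodule H R M \<and> hollow_module R (M\<lparr>carrier := H\<rparr>)"

definition maximal_hollow_submodule ::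
  "'b set \<Rightarrow> ('a, 'r) ring_scheme \<Rightarrow> ('a, 'b, 'm) module_scheme \<Rightarrow> bool" where
  "maximal_hollow_submodule H R M \<longleftrightarrow>
     hollow_submodule H R M \<and>
     (\<forall>H'. hollow_submodule H' R M \<and> H \<subseteq> H' \<longrightarrow> H' = H)"

text \<open>\<open>supplement L N R M\<close>: \<open>L\<close> is a supplement of \<open>N\<close> in \<open>M\<close>.\<close>

definition supplement ::
  "'b set \<Rightarrow> 'b set \<Rightarrow> ('a, 'r) ring_scheme \<Rightarrow> ('a, 'b, 'm) module_scheme \<Rightarrow> bool" where
  "supplement L N R M \<longleftrightarrow>
     submodule L R M \<and> N <+>\<^bsub>M\<^esub> L = carrier M \<and>
     (\<forall>L'. submodule L' R M \<and> L' \<subseteq> L \<and> N <+>\<^bsub>M\<^esub> L' = carrier M \<longrightarrow> L' = L)"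

definition supplemented ::
  "('a, 'r) ring_scheme \<Rightarrow> ('a, 'b, 'm) module_scheme \<Rightarrow> bool" where
  "supplemented R M \<longleftrightarrow> (\<forall>N. submodule N R M \<longrightarrow> (\<exists>L. supplement L N R M))"

definition maximal_submodule ::
  "'b set \<Rightarrow> ('a, 'r) ring_scheme \<Rightarrow> ('a, 'b, 'm) module_scheme \<Rightarrow> bool" where
  "maximal_submodule N R M \<longleftrightarrow>
     submodule N R M \<and> N \<noteq> carrier M \<and>
     (\<forall>N'. submodule N' R M \<and> N' \<noteq> carrier M \<and> N \<subseteq> N' \<longrightarrow> N' = N)"

definition coatomic ::
  "('a, 'r) ring_scheme \<Rightarrow> ('a, 'b, 'm) module_scheme \<Rightarrow> bool" where
  "coatomic R M \<longleftrightarrow>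
     (\<forall>N. submodule N R M \<and> N \<noteq> carrier M \<longrightarrow> (\<exists>N'. maximal_submodule N' R M \<and> N \<subseteq> N'))"

definition finitely_generated_module ::
  "('a, 'r) ring_scheme \<Rightarrow> ('a, 'b, 'm) module_scheme \<Rightarrow> bool" where
  "finitely_generated_module R M \<longleftrightarrow>
     (\<exists>S. finite S \<and> S \<subseteq> carrier M \<and>
        carrier M = {(\<Oplus>\<^bsub>M\<^esub>s\<in>S. c s \<odot>\<^bsub>M\<^esub> s) | c. c \<in> S \<rightarrow> carrier R})"

end

theory Submission
  imports Defs
begin

text \<open>
  The bridge between the two kinds of hypotheses is that a supplement \<open>L\<close> of a maximal submodule
  \<open>N\<close> is automatically a maximal hollow submodule, hence second. Indeed minimality of \<open>L\<close> forces
  each proper submodule of \<open>L\<close> into \<open>L \<inter> N\<close>, so two of them cannot add up to \<open>L\<close>; and if \<open>H\<close> is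
  hollow with \<open>L \<subseteq> H\<close>, the modular law gives \<open>H = (H \<inter> N) + L\<close> with \<open>H \<inter> N\<close> proper, so \<open>L = H\<close>.

  If \<open>M\<close> is coatomic and its maximal submodules have supplements, these supplements generate \<open>M\<close>:
  otherwise they would all lie in one maximal submodule \<open>N\<close>, and \<open>N\<close> would contain its own
  supplement. So \<open>M\<close> is a possibly infinite sum of second submodules, and each part of the theorem
  supplies a reason why finitely many suffice.

  In the first part \<open>M\<close> is finitely generated, therefore coatomic by Zorn's lemma, and each of the
  finitely many generators lies in a finite subsum. In the second part one collects the summands
  with the same annihilator: a sum of second submodules with a common annihilator is again second
  (lemma \<open>second_submodule_span\<close>), and there are only finitely many annihilators.
\<close>

section \<open>Generated submodules\<close>

context module
begin

definition span :: "'c set \<Rightarrow> 'c set" where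
  "span X = \<Inter>{N. submodule N R M \<and> X \<subseteq> N}"

lemma submodule_zero: "submodule N R M \<Longrightarrow> \<zero>\<^bsub>M\<^esub> \<in> N"
  using subgroup.one_closed[OF submodule.axioms(1)] by fastforce

text \<open>Additive inverses are multiples by \<open>\<ominus> \<one>\<close>, so closure under them follows from closure
  under scalars.\<close>

lemma submoduleI':
  assumes "H \<subseteq> carrier M" "\<zero>\<^bsub>M\<^esub> \<in> H"
    and "\<And>a b. \<lbrakk>a \<in> H; b \<in> H\<rbrakk> \<Longrightarrow> a \<oplus>\<^bsub>M\<^esub> b \<in> H"
    and smult: "\<And>a x. \<lbrakk>a \<in> carrier R; x \<in> H\<rbrakk> \<Longrightarrow> a \<odot>\<^bsub>M\<^esub> x \<in> H"
  shows "submodule H R M"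
proof (rule submoduleI)
  fix x assume "x \<in> H"
  then show "\<ominus>\<^bsub>M\<^esub> x \<in> H"
    using smult[of "\<ominus> \<one>" x] assms(1) smult_l_minus[of \<one> x] by auto
qed (use assms in auto)

lemma span_submodule:
  assumes "X \<subseteq> carrier M"
  shows "submodule (span X) R M"
proof (rule submoduleI')
  show "span X \<subseteq> carrier M"
    unfolding span_def using assms carrier_is_submodule by blast
qed (use submodule_zero submoduleE(4,5) in \<open>auto simp: span_def\<close>)

lemma span_superset: "X \<subseteq> span X"
  by (auto simp: span_def)

lemma span_minimal: "submodule N R M \<Longrightarrow> X \<subseteq> N \<Longrightarrow> span X \<subseteq> N"
  by (auto simp: span_def)

lemma span_mono: "X \<subseteq> Y \<Longrightarrow> span X \<subseteq> span Y"
  by (auto simp: span_def)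

lemma finsum_in_submodule:
  assumes "submodule N R M" "finite A" "f \<in> A \<rightarrow> N"
  shows "(\<Oplus>\<^bsub>M\<^esub>i\<in>A. f i) \<in> N"
  using assms(2,3)
proof (induction A rule: finite_induct)
  case empty
  then show ?case by (simp add: submodule_zero[OF assms(1)])
next
  case (insert x F)
  have "f \<in> F \<rightarrow> carrier M" "f x \<in> carrier M"
    using insert.prems submoduleE(1)[OF assms(1)] by auto
  with insert show ?case
    by (simp add: submoduleE(5)[OF assms(1)] Pi_def)
qed

text \<open>Sums are finitary, so membership in a generated submodule has a finite witness.\<close>

lemma span_Union_finite:
  assumes "\<And>K. K \<in> F \<Longrightarrow> K \<subseteq> carrier M" and "x \<in> span (\<Union>F)"
  shows "\<exists>F'. finite F' \<and> F' \<subseteq> F \<and> x \<in> span (\<Union>F')"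
proof -
  let ?W = "{x. \<exists>F'. finite F' \<and> F' \<subseteq> F \<and> x \<in> span (\<Union>F')}"
  have sub: "submodule (span (\<Union>F')) R M" if "F' \<subseteq> F" for F'
    using that assms(1) by (intro span_submodule) blast
  have "submodule ?W R M"
  proof (rule submoduleI')
    show "?W \<subseteq> carrier M" using sub submoduleE(1) by blast
    show "\<zero>\<^bsub>M\<^esub> \<in> ?W" using sub[of "{}"] submodule_zero by blast
  next
    fix a b assume "a \<in> ?W" "b \<in> ?W"
    then obtain A B where A: "finite A" "A \<subseteq> F" "a \<in> span (\<Union>A)"
      and B: "finite B" "B \<subseteq> F" "b \<in> span (\<Union>B)" by blast
    have "a \<in> span (\<Union>(A \<union> B))" "b \<in> span (\<Union>(A \<union> B))"
      using A(3) B(3) span_mono[of "\<Union>A" "\<Union>(A \<union> B)"] span_mono[of "\<Union>B" "\<Union>(A \<union> B)"] by auto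
    then have "a \<oplus>\<^bsub>M\<^esub> b \<in> span (\<Union>(A \<union> B))"
      using submoduleE(5)[OF sub[of "A \<union> B"]] A B by blast
    then show "a \<oplus>\<^bsub>M\<^esub> b \<in> ?W" using A B by blast
  next
    fix a x assume "a \<in> carrier R" "x \<in> ?W"
    then show "a \<odot>\<^bsub>M\<^esub> x \<in> ?W" using sub submoduleE(4) by blast
  qed
  moreover have "\<Union>F \<subseteq> ?W"
  proof
    fix y assume "y \<in> \<Union>F"
    then obtain K where "K \<in> F" "y \<in> K" by blast
    then have "finite {K} \<and> {K} \<subseteq> F \<and> y \<in> span (\<Union>{K})" using span_superset[of K] by auto
    then show "y \<in> ?W" by blast
  qed
  ultimately have "span (\<Union>F) \<subseteq> ?W" by (rule span_minimal)
  then show ?thesis using assms(2) by blast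
qed

lemma finsum_set_submodule:
  fixes K :: "nat \<Rightarrow> 'c set"
  assumes K: "\<And>i. i < n \<Longrightarrow> submodule (K i) R M"
  shows "submodule {(\<Oplus>\<^bsub>M\<^esub>i\<in>{..<n}. x i) | x. x \<in> (\<Pi> i\<in>{..<n}. K i)} R M" (is "submodule ?S R M")
proof -
  have Kc: "x \<in> {..<n} \<rightarrow> carrier M" if "x \<in> (\<Pi> i\<in>{..<n}. K i)" for x
    using that submoduleE(1)[OF K] by (fastforce simp: Pi_def)
  show ?thesis
  proof (rule submoduleI')
    show "?S \<subseteq> carrier M" using Kc by (auto intro!: M.finsum_closed)
    have "\<zero>\<^bsub>M\<^esub> = (\<Oplus>\<^bsub>M\<^esub>i\<in>{..<n}. \<zero>\<^bsub>M\<^esub>)" by simp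
    moreover have "(\<lambda>i. \<zero>\<^bsub>M\<^esub>) \<in> (\<Pi> i\<in>{..<n}. K i)" using submodule_zero[OF K] by auto
    ultimately show "\<zero>\<^bsub>M\<^esub> \<in> ?S" by blast
  next
    fix a b assume "a \<in> ?S" "b \<in> ?S"
    then obtain x y where x: "x \<in> (\<Pi> i\<in>{..<n}. K i)" "a = (\<Oplus>\<^bsub>M\<^esub>i\<in>{..<n}. x i)"
      and y: "y \<in> (\<Pi> i\<in>{..<n}. K i)" "b = (\<Oplus>\<^bsub>M\<^esub>i\<in>{..<n}. y i)" by blast
    have "a \<oplus>\<^bsub>M\<^esub> b = (\<Oplus>\<^bsub>M\<^esub>i\<in>{..<n}. x i \<oplus>\<^bsub>M\<^esub> y i)"
      using Kc[OF x(1)] Kc[OF y(1)] by (simp add: x y)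
    moreover have "(\<lambda>i. x i \<oplus>\<^bsub>M\<^esub> y i) \<in> (\<Pi> i\<in>{..<n}. K i)"
      using x(1) y(1) submoduleE(5)[OF K] by (simp add: Pi_iff)
    ultimately show "a \<oplus>\<^bsub>M\<^esub> b \<in> ?S" by blast
  next
    fix r a assume r: "r \<in> carrier R" and "a \<in> ?S"
    then obtain x where x: "x \<in> (\<Pi> i\<in>{..<n}. K i)" "a = (\<Oplus>\<^bsub>M\<^esub>i\<in>{..<n}. x i)" by blast
    have "r \<odot>\<^bsub>M\<^esub> a = (\<Oplus>\<^bsub>M\<^esub>i\<in>{..<n}. r \<odot>\<^bsub>M\<^esub> x i)"
      using Kc[OF x(1)] r by (simp add: x finsum_smult_ldistr)
    moreover have "(\<lambda>i. r \<odot>\<^bsub>M\<^esub> x i) \<in> (\<Pi> i\<in>{..<n}. K i)"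
      using x(1) r submoduleE(4)[OF K] by auto
    ultimately show "r \<odot>\<^bsub>M\<^esub> a \<in> ?S" by blast
  qed
qed

text \<open>The indexed sums in the definition of second representability form a submodule
  containing every member of \<open>F\<close>, so it is enough to generate \<open>M\<close>. In this form the number
  and the order of the summands no longer matter.\<close>

lemma second_representableI:
  assumes "finite F" and second: "\<And>K. K \<in> F \<Longrightarrow> second_submodule K R M"
    and gen: "carrier M \<subseteq> span (\<Union>F)"
  shows "second_representable R M"
proof -
  obtain K where K: "bij_betw K {..<card F} F"
    using ex_bij_betw_nat_finite[OF \<open>finite F\<close>] by (auto simp: atLeast0LessThan)
  let ?n = "card F"
  let ?S = "{(\<Oplus>\<^bsub>M\<^esub>i\<in>{..<?n}. x i) | x. x \<in> (\<Pi> i\<in>{..<?n}. K i)}"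
  have KF: "K i \<in> F" if "i < ?n" for i using K that by (auto simp: bij_betw_def)
  have sub: "submodule (K i) R M" if "i < ?n" for i
    using second[OF KF[OF that]] by (simp add: second_submodule_def)
  have S: "submodule ?S R M" by (rule finsum_set_submodule[OF sub])
  have "\<Union>F \<subseteq> ?S"
  proof
    fix y assume "y \<in> \<Union>F"
    then obtain j where j: "j < ?n" "y \<in> K j" using K by (auto simp: bij_betw_def)
    have yM: "y \<in> carrier M" using j submoduleE(1)[OF sub] by blast
    \<comment> \<open>an element of one summand is the sum of the family vanishing at all other indices\<close>
    have "(\<Oplus>\<^bsub>M\<^esub>i\<in>{..<?n}. if j = i then y else \<zero>\<^bsub>M\<^esub>) = y"
      using M.finsum_singleton[of j "{..<?n}" "\<lambda>_. y"] j yM by simp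
    moreover have "(\<lambda>i. if j = i then y else \<zero>\<^bsub>M\<^esub>) \<in> (\<Pi> i\<in>{..<?n}. K i)"
      using j submodule_zero[OF sub] by auto
    ultimately show "y \<in> ?S" by (smt (verit) mem_Collect_eq)
  qed
  then have "carrier M = ?S"
    using span_minimal[OF S] gen submoduleE(1)[OF S] by blast
  then show ?thesis
    unfolding second_representable_def using second KF by blast
qed

section \<open>Sums of second submodules with a common annihilator\<close>

lemma ideal_smult_mono: "K \<subseteq> K' \<Longrightarrow> ideal_smult M I K \<subseteq> ideal_smult M I K'"
  unfolding ideal_smult_def by (intro Collect_mono ex_mono) (auto simp: Pi_iff)

text \<open>For closure under addition, \<open>snoc\<close> appends a single product \<open>b y\<close> to a sum; adding a
  second sum then means appending its products one after the other.\<close>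

lemma ideal_smult_submodule:
  assumes I: "ideal I R" and K: "submodule K R M"
  shows "submodule (ideal_smult M I K) R M"
proof -
  let ?P = "\<lambda>n a k. a \<in> {..<n} \<rightarrow> I \<and> k \<in> {..<n} \<rightarrow> K"
  let ?s = "\<lambda>n a k. \<Oplus>\<^bsub>M\<^esub>i\<in>{..<n::nat}. a i \<odot>\<^bsub>M\<^esub> k i"
  have Ic: "a \<in> carrier R" if "a \<in> I" for a
    using ideal.Icarr[OF I that] .
  have Kc: "k \<in> carrier M" if "k \<in> K" for k
    using submoduleE(1)[OF K] that by blast
  have summands: "(\<lambda>i. a i \<odot>\<^bsub>M\<^esub> k i) \<in> {..<n} \<rightarrow> carrier M" if "?P n a k" for n and a :: "nat \<Rightarrow> 'a" and k
    using that Ic Kc by (fastforce simp: Pi_def)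
  have mem: "?s n a k \<in> ideal_smult M I K" if "?P n a k" for n a k
    using that unfolding ideal_smult_def by blast
  have snoc: "x \<oplus>\<^bsub>M\<^esub> b \<odot>\<^bsub>M\<^esub> y \<in> ideal_smult M I K"
    if x: "x \<in> ideal_smult M I K" and b: "b \<in> I" and y: "y \<in> K" for x b y
  proof -
    obtain n a k where P: "?P n a k" and xe: "x = ?s n a k"
      using x unfolding ideal_smult_def by blast
    have "?s (Suc n) (a(n := b)) (k(n := y)) = b \<odot>\<^bsub>M\<^esub> y \<oplus>\<^bsub>M\<^esub> x"
    proof -
      have "?s n (a(n := b)) (k(n := y)) = x"
        unfolding xe using summands[OF P] by (intro M.finsum_cong') auto
      moreover have "(\<lambda>i. (a(n := b)) i \<odot>\<^bsub>M\<^esub> (k(n := y)) i) \<in> {..<n} \<rightarrow> carrier M"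
        using summands[OF P] by auto
      ultimately show ?thesis
        using b y Ic Kc by (simp add: lessThan_Suc)
    qed
    moreover have P': "?P (Suc n) (a(n := b)) (k(n := y))"
      using P b y by (auto simp: less_Suc_eq)
    moreover have "x \<in> carrier M" unfolding xe using summands[OF P] by (rule M.finsum_closed)
    ultimately show ?thesis
      using mem[OF P'] b y Ic Kc by (simp add: M.a_comm)
  qed
  show ?thesis
  proof (rule submoduleI')
    show "ideal_smult M I K \<subseteq> carrier M"
      unfolding ideal_smult_def using summands by (auto intro!: M.finsum_closed)
    show "\<zero>\<^bsub>M\<^esub> \<in> ideal_smult M I K"
      unfolding ideal_smult_def mem_Collect_eq by (rule exI[of _ 0]) simp
  next
    fix x z assume x: "x \<in> ideal_smult M I K" and "z \<in> ideal_smult M I K"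
    then obtain n a k where "?P n a k" and z: "z = ?s n a k"
      unfolding ideal_smult_def by blast
    have xc: "x \<in> carrier M"
      using x summands unfolding ideal_smult_def by (auto intro!: M.finsum_closed)
    have "x \<oplus>\<^bsub>M\<^esub> ?s n a k \<in> ideal_smult M I K" using \<open>?P n a k\<close>
    proof (induction n)
      case 0
      then show ?case using x xc by simp
    next
      case (Suc n)
      have P: "?P n a k" and an: "a n \<in> I" "k n \<in> K" using Suc.prems by auto
      have c: "?s n a k \<in> carrier M" using summands[OF P] by (rule M.finsum_closed)
      have "?s (Suc n) a k = a n \<odot>\<^bsub>M\<^esub> k n \<oplus>\<^bsub>M\<^esub> ?s n a k"
        using summands[OF P] an Ic Kc by (simp add: lessThan_Suc)
      then have "x \<oplus>\<^bsub>M\<^esub> ?s (Suc n) a k = (x \<oplus>\<^bsub>M\<^esub> ?s n a k) \<oplus>\<^bsub>M\<^esub> a n \<odot>\<^bsub>M\<^esub> k n"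
        using xc c an Ic Kc by (simp add: M.a_ac)
      then show ?case using snoc[OF Suc.IH[OF P] an] by simp
    qed
    then show "x \<oplus>\<^bsub>M\<^esub> z \<in> ideal_smult M I K" by (simp add: z)
  next
    fix r x assume r: "r \<in> carrier R" and "x \<in> ideal_smult M I K"
    then obtain n a k where P: "?P n a k" and x: "x = ?s n a k"
      unfolding ideal_smult_def by blast
    have "r \<odot>\<^bsub>M\<^esub> x = (\<Oplus>\<^bsub>M\<^esub>i\<in>{..<n}. r \<odot>\<^bsub>M\<^esub> (a i \<odot>\<^bsub>M\<^esub> k i))"
      unfolding x using summands[OF P] r by (simp add: finsum_smult_ldistr)
    also have "\<dots> = ?s n (\<lambda>i. r \<otimes> a i) k"
      using P r Ic Kc by (intro M.finsum_cong') (auto simp: smult_assoc1 Pi_def)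
    also have "\<dots> \<in> ideal_smult M I K"
      using P ideal.I_l_closed[OF I _ r] by (intro mem) auto
    finally show "r \<odot>\<^bsub>M\<^esub> x \<in> ideal_smult M I K" .
  qed
qed

lemma ideal_smult_subset:
  assumes I: "ideal I R" and K: "submodule K R M"
  shows "ideal_smult M I K \<subseteq> K"
proof
  fix x assume "x \<in> ideal_smult M I K"
  then obtain n :: nat and a k where *: "a \<in> {..<n} \<rightarrow> I" "k \<in> {..<n} \<rightarrow> K"
    and x: "x = (\<Oplus>\<^bsub>M\<^esub>i\<in>{..<n}. a i \<odot>\<^bsub>M\<^esub> k i)"
    unfolding ideal_smult_def by blast
  have "(\<lambda>i. a i \<odot>\<^bsub>M\<^esub> k i) \<in> {..<n} \<rightarrow> K"
    using * ideal.Icarr[OF I] submoduleE(4)[OF K] by (simp add: Pi_iff)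
  then show "x \<in> K" unfolding x by (rule finsum_in_submodule[OF K finite_lessThan])
qed

lemma ideal_smult_eq_zero_iff:
  assumes I: "ideal I R" and K: "submodule K R M"
  shows "ideal_smult M I K = {\<zero>\<^bsub>M\<^esub>} \<longleftrightarrow> I \<subseteq> annihilator R M K"
proof
  assume Z: "ideal_smult M I K = {\<zero>\<^bsub>M\<^esub>}"
  show "I \<subseteq> annihilator R M K"
  proof
    fix a assume a: "a \<in> I"
    have "a \<odot>\<^bsub>M\<^esub> x = \<zero>\<^bsub>M\<^esub>" if x: "x \<in> K" for x
    proof -
      have "a \<odot>\<^bsub>M\<^esub> x \<in> carrier M"
        using ideal.Icarr[OF I a] x submoduleE(1)[OF K] by blast
      then have "(\<Oplus>\<^bsub>M\<^esub>i\<in>{..<1::nat}. a \<odot>\<^bsub>M\<^esub> x) = a \<odot>\<^bsub>M\<^esub> x"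
        by (simp add: lessThan_Suc)
      moreover have "(\<Oplus>\<^bsub>M\<^esub>i\<in>{..<1::nat}. a \<odot>\<^bsub>M\<^esub> x) \<in> ideal_smult M I K"
        unfolding ideal_smult_def mem_Collect_eq
        by (rule exI[of _ 1], rule exI[of _ "\<lambda>_. a"], rule exI[of _ "\<lambda>_. x"]) (use a x in auto)
      ultimately show ?thesis using Z by simp
    qed
    then show "a \<in> annihilator R M K"
      using ideal.Icarr[OF I a] by (simp add: annihilator_def)
  qed
next
  assume ann: "I \<subseteq> annihilator R M K"
  have "(\<Oplus>\<^bsub>M\<^esub>i\<in>{..<n}. a i \<odot>\<^bsub>M\<^esub> k i) = \<zero>\<^bsub>M\<^esub>"
    if "a \<in> {..<n} \<rightarrow> I" "k \<in> {..<n} \<rightarrow> K" for n :: nat and a k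
    using that ann by (intro M.add.finprod_one_eqI) (auto simp: annihilator_def Pi_def)
  then have "ideal_smult M I K \<subseteq> {\<zero>\<^bsub>M\<^esub>}"
    unfolding ideal_smult_def by auto
  then show "ideal_smult M I K = {\<zero>\<^bsub>M\<^esub>}"
    using submodule_zero[OF ideal_smult_submodule[OF I K]] by blast
qed

lemma annihilator_span:
  assumes "a \<in> carrier R" and "X \<subseteq> carrier M" and "\<And>x. x \<in> X \<Longrightarrow> a \<odot>\<^bsub>M\<^esub> x = \<zero>\<^bsub>M\<^esub>"
  shows "a \<in> annihilator R M (span X)"
proof -
  have "submodule {x \<in> carrier M. a \<odot>\<^bsub>M\<^esub> x = \<zero>\<^bsub>M\<^esub>} R M"
  proof (rule submoduleI')
    fix r x assume r: "r \<in> carrier R" and x: "x \<in> {x \<in> carrier M. a \<odot>\<^bsub>M\<^esub> x = \<zero>\<^bsub>M\<^esub>}"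
    have "a \<odot>\<^bsub>M\<^esub> (r \<odot>\<^bsub>M\<^esub> x) = r \<odot>\<^bsub>M\<^esub> (a \<odot>\<^bsub>M\<^esub> x)"
      using r x assms(1) smult_assoc1[of a r x] smult_assoc1[of r a x] by (simp add: R.m_comm)
    then show "r \<odot>\<^bsub>M\<^esub> x \<in> {x \<in> carrier M. a \<odot>\<^bsub>M\<^esub> x = \<zero>\<^bsub>M\<^esub>}" using r x by simp
  qed (use assms(1) in \<open>auto simp: smult_r_distr\<close>)
  then have "span X \<subseteq> {x \<in> carrier M. a \<odot>\<^bsub>M\<^esub> x = \<zero>\<^bsub>M\<^esub>}"
    by (rule span_minimal) (use assms in auto)
  then show ?thesis using assms(1) by (auto simp: annihilator_def)
qed

text \<open>An ideal inside the common annihilator kills the sum; any other ideal kills none of the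
  summands, hence reproduces each of them and so reproduces the sum.\<close>

lemma second_submodule_span:
  assumes second: "\<And>K. K \<in> F \<Longrightarrow> second_submodule K R M"
    and ann: "\<And>K. K \<in> F \<Longrightarrow> annihilator R M K = p"
    and "F \<noteq> {}"
  shows "second_submodule (span (\<Union>F)) R M"
  unfolding second_submodule_def
proof (intro conjI allI impI)
  have sub: "submodule K R M" if "K \<in> F" for K
    using second[OF that] by (simp add: second_submodule_def)
  have UF: "\<Union>F \<subseteq> carrier M" using submoduleE(1)[OF sub] by blast
  show S: "submodule (span (\<Union>F)) R M" using UF by (rule span_submodule)
  show "span (\<Union>F) \<noteq> {\<zero>\<^bsub>M\<^esub>}"
  proof
    assume Z: "span (\<Union>F) = {\<zero>\<^bsub>M\<^esub>}"
    obtain K where K: "K \<in> F" using \<open>F \<noteq> {}\<close> by blast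
    then have "K \<subseteq> {\<zero>\<^bsub>M\<^esub>}" using span_superset[of "\<Union>F"] Z by blast
    then show False
      using second[OF K] submodule_zero[OF sub[OF K]] by (auto simp: second_submodule_def)
  qed
  fix I assume I: "ideal I R"
  show "ideal_smult M I (span (\<Union>F)) = span (\<Union>F) \<or> ideal_smult M I (span (\<Union>F)) = {\<zero>\<^bsub>M\<^esub>}"
  proof (cases "I \<subseteq> p")
    case True
    have "I \<subseteq> annihilator R M (span (\<Union>F))"
    proof
      fix a assume a: "a \<in> I"
      have "a \<odot>\<^bsub>M\<^esub> x = \<zero>\<^bsub>M\<^esub>" if "x \<in> \<Union>F" for x
        using that a True ann by (auto simp: annihilator_def)
      then show "a \<in> annihilator R M (span (\<Union>F))"
        by (rule annihilator_span[OF ideal.Icarr[OF I a] UF])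
    qed
    then show ?thesis using ideal_smult_eq_zero_iff[OF I S] by blast
  next
    case False
    have "\<Union>F \<subseteq> ideal_smult M I (span (\<Union>F))"
    proof (rule Union_least)
      fix K assume K: "K \<in> F"
      have "ideal_smult M I K \<noteq> {\<zero>\<^bsub>M\<^esub>}"
        using ideal_smult_eq_zero_iff[OF I sub[OF K]] ann[OF K] False by simp
      then have "K = ideal_smult M I K"
        using second[OF K] I by (auto simp: second_submodule_def)
      also have "\<dots> \<subseteq> ideal_smult M I (span (\<Union>F))"
        using K span_superset[of "\<Union>F"] by (intro ideal_smult_mono) blast
      finally show "K \<subseteq> ideal_smult M I (span (\<Union>F))" .
    qed
    then have "span (\<Union>F) \<subseteq> ideal_smult M I (span (\<Union>F))"
      by (rule span_minimal[OF ideal_smult_submodule[OF I S]])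
    then show ?thesis using ideal_smult_subset[OF I S] by blast
  qed
qed

section \<open>Supplements of maximal submodules\<close>

text \<open>Hollowness of \<open>H\<close> speaks of submodules of the module with carrier \<open>H\<close>; this brings it back
  to submodules of \<open>M\<close>.\<close>

lemma submodule_of_submodule_iff:
  assumes H: "submodule H R M"
  shows "submodule N R (M\<lparr>carrier := H\<rparr>) \<longleftrightarrow> submodule N R M \<and> N \<subseteq> H"
proof
  have MH: "module R (M\<lparr>carrier := H\<rparr>)"
    by (rule submodule.submodule_is_module[OF H module_axioms])
  {
    assume N: "submodule N R (M\<lparr>carrier := H\<rparr>)"
    have "N \<subseteq> H" using module.submoduleE(1)[OF MH N] by simp
    moreover have "module R (M\<lparr>carrier := N\<rparr>)"
      using submodule.submodule_is_module[OF N MH] by simp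
    ultimately show "submodule N R M \<and> N \<subseteq> H"
      using module_incl_imp_submodule submoduleE(1)[OF H] by blast
  next
    assume "submodule N R M \<and> N \<subseteq> H"
    then show "submodule N R (M\<lparr>carrier := H\<rparr>)"
      using module.module_incl_imp_submodule[OF MH, of N]
        submodule.submodule_is_module[of N R M, OF _ module_axioms] by simp
  }
qed

lemma set_add_in_submodule:
  assumes "submodule N R M" "A \<subseteq> N" "B \<subseteq> N"
  shows "A <+>\<^bsub>M\<^esub> B \<subseteq> N"
  using assms submoduleE(5)[OF assms(1)] by (auto simp: set_add_def')

lemma set_add_submodule:
  assumes A: "submodule A R M" and B: "submodule B R M"
  shows "submodule (A <+>\<^bsub>M\<^esub> B) R M" and "A \<subseteq> A <+>\<^bsub>M\<^esub> B" and "B \<subseteq> A <+>\<^bsub>M\<^esub> B"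
proof -
  note Ac = submoduleE(1)[OF A] and Bc = submoduleE(1)[OF B]
  show AA: "A \<subseteq> A <+>\<^bsub>M\<^esub> B"
    using Ac submodule_zero[OF B] by (force simp: set_add_def')
  show "B \<subseteq> A <+>\<^bsub>M\<^esub> B"
    using Bc submodule_zero[OF A] by (force simp: set_add_def')
  show "submodule (A <+>\<^bsub>M\<^esub> B) R M"
  proof (rule submoduleI')
    show "A <+>\<^bsub>M\<^esub> B \<subseteq> carrier M"
      by (rule set_add_in_submodule[OF carrier_is_submodule Ac Bc])
    show "\<zero>\<^bsub>M\<^esub> \<in> A <+>\<^bsub>M\<^esub> B" using AA submodule_zero[OF A] by blast
  next
    fix x y assume "x \<in> A <+>\<^bsub>M\<^esub> B" "y \<in> A <+>\<^bsub>M\<^esub> B"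
    then obtain a b c d where *: "a \<in> A" "b \<in> B" "c \<in> A" "d \<in> B" "x = a \<oplus>\<^bsub>M\<^esub> b" "y = c \<oplus>\<^bsub>M\<^esub> d"
      by (auto simp: set_add_def')
    moreover have "a \<in> carrier M" "b \<in> carrier M" "c \<in> carrier M" "d \<in> carrier M"
      using * Ac Bc by auto
    ultimately have "x \<oplus>\<^bsub>M\<^esub> y = (a \<oplus>\<^bsub>M\<^esub> c) \<oplus>\<^bsub>M\<^esub> (b \<oplus>\<^bsub>M\<^esub> d)" by (simp add: M.a_ac)
    moreover have "a \<oplus>\<^bsub>M\<^esub> c \<in> A" "b \<oplus>\<^bsub>M\<^esub> d \<in> B"
      using * submoduleE(5)[OF A] submoduleE(5)[OF B] by auto
    ultimately show "x \<oplus>\<^bsub>M\<^esub> y \<in> A <+>\<^bsub>M\<^esub> B" by (auto simp: set_add_def')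
  next
    fix r x assume r: "r \<in> carrier R" and "x \<in> A <+>\<^bsub>M\<^esub> B"
    then obtain a b where *: "a \<in> A" "b \<in> B" "x = a \<oplus>\<^bsub>M\<^esub> b" by (auto simp: set_add_def')
    then have "r \<odot>\<^bsub>M\<^esub> x = r \<odot>\<^bsub>M\<^esub> a \<oplus>\<^bsub>M\<^esub> r \<odot>\<^bsub>M\<^esub> b"
      using r Ac Bc by (simp add: smult_r_distr subset_iff)
    moreover have "r \<odot>\<^bsub>M\<^esub> a \<in> A" "r \<odot>\<^bsub>M\<^esub> b \<in> B"
      using * r submoduleE(4)[OF A] submoduleE(4)[OF B] by auto
    ultimately show "r \<odot>\<^bsub>M\<^esub> x \<in> A <+>\<^bsub>M\<^esub> B" by (auto simp: set_add_def')
  qed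
qed

lemma submodule_inter:
  assumes "submodule A R M" "submodule B R M"
  shows "submodule (A \<inter> B) R M"
proof (rule submoduleI')
  show "A \<inter> B \<subseteq> carrier M" using submoduleE(1)[OF assms(1)] by blast
qed (use submodule_zero submoduleE(4,5) assms in auto)

lemma modular_law:
  assumes "submodule H R M" "submodule N R M" "submodule L R M"
    and "L \<subseteq> H" "N <+>\<^bsub>M\<^esub> L = carrier M"
  shows "(H \<inter> N) <+>\<^bsub>M\<^esub> L = H"
proof
  show "(H \<inter> N) <+>\<^bsub>M\<^esub> L \<subseteq> H" using assms by (intro set_add_in_submodule) auto
  show "H \<subseteq> (H \<inter> N) <+>\<^bsub>M\<^esub> L"
  proof
    fix h assume h: "h \<in> H"
    then have "h \<in> N <+>\<^bsub>M\<^esub> L" using assms submoduleE(1) by blast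
    then obtain n l where nl: "n \<in> N" "l \<in> L" "h = n \<oplus>\<^bsub>M\<^esub> l" by (auto simp: set_add_def')
    have c: "n \<in> carrier M" "l \<in> carrier M" using nl assms submoduleE(1) by blast+
    have "h \<oplus>\<^bsub>M\<^esub> \<ominus>\<^bsub>M\<^esub> l \<in> H"
      using h nl assms by (intro submoduleE(5) submoduleE(3)) auto
    moreover have "h \<oplus>\<^bsub>M\<^esub> \<ominus>\<^bsub>M\<^esub> l = n"
      using c by (simp add: nl M.a_assoc M.r_neg)
    ultimately show "h \<in> (H \<inter> N) <+>\<^bsub>M\<^esub> L" using nl by (auto simp: set_add_def')
  qed
qed

lemma supplement_not_le_maximal:
  assumes N: "maximal_submodule N R M" and L: "supplement L N R M"
  shows "\<not> L \<subseteq> N"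
proof
  have Ns: "submodule N R M" "N \<noteq> carrier M" using N by (auto simp: maximal_submodule_def)
  assume "L \<subseteq> N"
  then have "N <+>\<^bsub>M\<^esub> L \<subseteq> N" using set_add_in_submodule[OF Ns(1)] by blast
  then have "carrier M \<subseteq> N" using L by (simp add: supplement_def)
  then show False using Ns submoduleE(1)[OF Ns(1)] by blast
qed

text \<open>A submodule of \<open>L\<close> outside \<open>N\<close> still sums with \<open>N\<close> to all of \<open>M\<close>, as \<open>N\<close> is maximal, so it
  is \<open>L\<close> by minimality. Thus \<open>L \<inter> N\<close> is the largest proper submodule of \<open>L\<close>.\<close>

lemma supplement_maximal_proper_submodule:
  assumes N: "maximal_submodule N R M" and L: "supplement L N R M"
    and A: "submodule A R M" "A \<subseteq> L" "A \<noteq> L"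
  shows "A \<subseteq> N"
proof (rule ccontr)
  assume "\<not> A \<subseteq> N"
  have Ns: "submodule N R M" using N by (simp add: maximal_submodule_def)
  note s = set_add_submodule[OF Ns A(1)]
  have "N <+>\<^bsub>M\<^esub> A \<noteq> N" using s(3) \<open>\<not> A \<subseteq> N\<close> by blast
  then have "N <+>\<^bsub>M\<^esub> A = carrier M"
    using N s(1,2) unfolding maximal_submodule_def by blast
  then show False using L A unfolding supplement_def by blast
qed

text \<open>Two proper submodules of \<open>L\<close> lie in \<open>N\<close>, and so does their sum, whereas \<open>L\<close> does not. For
  maximality, a hollow \<open>H\<close> properly containing \<open>L\<close> would be the sum of its proper submodules
  \<open>H \<inter> N\<close> and \<open>L\<close>.\<close>

lemma supplement_maximal_is_maximal_hollow:
  assumes N: "maximal_submodule N R M" and L: "supplement L N R M"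
  shows "maximal_hollow_submodule L R M"
proof -
  have Ns: "submodule N R M" and Ls: "submodule L R M" and NL: "N <+>\<^bsub>M\<^esub> L = carrier M"
    using N L by (auto simp: maximal_submodule_def supplement_def)
  have notin: "\<not> L \<subseteq> N" by (rule supplement_not_le_maximal[OF N L])
  have "A <+>\<^bsub>M\<^esub> B \<noteq> L"
    if "submodule A R M" "A \<subseteq> L" "A \<noteq> L" "submodule B R M" "B \<subseteq> L" "B \<noteq> L" for A B
    using set_add_in_submodule[OF Ns] supplement_maximal_proper_submodule[OF N L] that notin by metis
  then have hollow: "hollow_submodule L R M"
    using Ls unfolding hollow_submodule_def hollow_module_def small_submodule_def
    by (simp add: submodule_of_submodule_iff set_add_def')
  have "H = L" if H: "hollow_submodule H R M" and LH: "L \<subseteq> H" for H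
  proof (rule ccontr)
    assume "H \<noteq> L"
    have Hs: "submodule H R M" using H by (simp add: hollow_submodule_def)
    have "(H \<inter> N) <+>\<^bsub>M\<^esub> L = H" by (rule modular_law[OF Hs Ns Ls LH NL])
    moreover have "H \<inter> N \<noteq> H" using notin LH by blast
    ultimately show False
      using H \<open>H \<noteq> L\<close> LH Ls submodule_inter[OF Hs Ns]
      unfolding hollow_submodule_def hollow_module_def small_submodule_def
      by (auto simp: submodule_of_submodule_iff set_add_def')
  qed
  with hollow show ?thesis by (auto simp: maximal_hollow_submodule_def)
qed

lemma coatomic_span_second:
  assumes coatomic: "coatomic R M"
    and suppl: "\<And>N. maximal_submodule N R M \<Longrightarrow> \<exists>L. supplement L N R M"
    and hollow: "\<And>H. maximal_hollow_submodule H R M \<Longrightarrow> second_submodule H R M"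
  shows "carrier M \<subseteq> span (\<Union>{K. second_submodule K R M})"
proof (rule ccontr)
  let ?S = "span (\<Union>{K. second_submodule K R M})"
  assume *: "\<not> carrier M \<subseteq> ?S"
  have S: "submodule ?S R M"
    by (rule span_submodule) (auto simp: second_submodule_def dest: submoduleE(1))
  then obtain N where N: "maximal_submodule N R M" "?S \<subseteq> N"
    using coatomic * unfolding coatomic_def by blast
  obtain L where L: "supplement L N R M" using suppl[OF N(1)] ..
  have "L \<subseteq> ?S"
    using hollow[OF supplement_maximal_is_maximal_hollow[OF N(1) L]]
      span_superset[of "\<Union>{K. second_submodule K R M}"] by blast
  then show False using supplement_not_le_maximal[OF N(1) L] N(2) by blast
qed

section \<open>Finitely generated modules\<close>

lemma finitely_generated_spanE:
  assumes "finitely_generated_module R M"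
  obtains S where "finite S" "S \<subseteq> carrier M"
    "\<And>N. submodule N R M \<Longrightarrow> S \<subseteq> N \<Longrightarrow> N = carrier M"
proof -
  obtain S where S: "finite S" "S \<subseteq> carrier M"
    and gen: "carrier M = {(\<Oplus>\<^bsub>M\<^esub>s\<in>S. c s \<odot>\<^bsub>M\<^esub> s) | c. c \<in> S \<rightarrow> carrier R}"
    using assms unfolding finitely_generated_module_def by blast
  have "N = carrier M" if N: "submodule N R M" "S \<subseteq> N" for N
  proof
    show "N \<subseteq> carrier M" by (rule submoduleE(1)[OF N(1)])
    have "(\<Oplus>\<^bsub>M\<^esub>s\<in>S. c s \<odot>\<^bsub>M\<^esub> s) \<in> N" if "c \<in> S \<rightarrow> carrier R" for c
      using that N(2) submoduleE(4)[OF N(1)] by (intro finsum_in_submodule[OF N(1) S(1)]) auto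
    then show "carrier M \<subseteq> N" by (subst gen) blast
  qed
  with S show thesis using that by blast
qed

lemma chain_Union_submodule:
  assumes chain: "subset.chain {N. submodule N R M} C" and "C \<noteq> {}"
  shows "submodule (\<Union>C) R M"
proof (rule submoduleI')
  have C: "submodule N R M" if "N \<in> C" for N
    using chain that by (auto simp: subset_chain_def)
  show "\<Union>C \<subseteq> carrier M" using submoduleE(1)[OF C] by blast
  show "\<zero>\<^bsub>M\<^esub> \<in> \<Union>C" using submodule_zero[OF C] \<open>C \<noteq> {}\<close> by blast
  fix a b assume "a \<in> \<Union>C" "b \<in> \<Union>C"
  then obtain N where "N \<in> C" "a \<in> N" "b \<in> N"
    using chain unfolding subset_chain_def by blast
  then show "a \<oplus>\<^bsub>M\<^esub> b \<in> \<Union>C" using submoduleE(5)[OF C] by blast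
next
  fix a x assume "a \<in> carrier R" "x \<in> \<Union>C"
  then show "a \<odot>\<^bsub>M\<^esub> x \<in> \<Union>C"
    using chain submoduleE(4) unfolding subset_chain_def by blast
qed

text \<open>If the union of a chain of proper submodules were \<open>M\<close>, one member of the chain would already
  contain the finitely many generators; so Zorn's lemma applies.\<close>

lemma finitely_generated_coatomic:
  assumes "finitely_generated_module R M"
  shows "coatomic R M"
  unfolding coatomic_def
proof (intro allI impI, elim conjE)
  fix N assume N: "submodule N R M" "N \<noteq> carrier M"
  obtain S where S: "finite S" "S \<subseteq> carrier M"
    and gen: "\<And>N. submodule N R M \<Longrightarrow> S \<subseteq> N \<Longrightarrow> N = carrier M"
    using finitely_generated_spanE[OF assms] by blast
  let ?A = "{N'. submodule N' R M \<and> N' \<noteq> carrier M \<and> N \<subseteq> N'}"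
  have "\<exists>X\<in>?A. \<forall>Y\<in>?A. X \<subseteq> Y \<longrightarrow> Y = X"
  proof (rule subset_Zorn_nonempty)
    show "?A \<noteq> {}" using N by blast
    fix C assume ne: "C \<noteq> {}" and chain: "subset.chain ?A C"
    have "submodule (\<Union>C) R M"
      using chain_Union_submodule[OF _ ne] chain by (auto simp: subset_chain_def)
    moreover have "N \<subseteq> \<Union>C" using ne chain by (fastforce simp: subset_chain_def)
    moreover have "\<Union>C \<noteq> carrier M"
    proof
      assume "\<Union>C = carrier M"
      then obtain B where "B \<in> C" "S \<subseteq> B"
        using finite_subset_Union_chain[OF S(1) _ ne chain] S(2) by blast
      then show False using gen[of B] chain by (auto simp: subset_chain_def)
    qed
    ultimately show "\<Union>C \<in> ?A" by blast
  qed
  then obtain X where X: "X \<in> ?A" and max: "\<forall>Y\<in>?A. X \<subseteq> Y \<longrightarrow> Y = X" by (rule bexE)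
  have "Y = X" if "submodule Y R M" "Y \<noteq> carrier M" "X \<subseteq> Y" for Y
    using bspec[OF max, of Y] X that by auto
  then have "maximal_submodule X R M" using X by (simp add: maximal_submodule_def)
  then show "\<exists>N'. maximal_submodule N' R M \<and> N \<subseteq> N'" using X by (intro exI[of _ X]) simp
qed

section \<open>Second representability\<close>

lemma finitely_generated_second_representable:
  assumes fg: "finitely_generated_module R M"
    and sum: "carrier M \<subseteq> span (\<Union>{K. second_submodule K R M})"
  shows "second_representable R M"
proof -
  obtain S where S: "finite S" "S \<subseteq> carrier M"
    and gen: "\<And>N. submodule N R M \<Longrightarrow> S \<subseteq> N \<Longrightarrow> N = carrier M"
    using finitely_generated_spanE[OF fg] by blast
  have Kc: "K \<subseteq> carrier M" if "second_submodule K R M" for K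
    using that submoduleE(1) by (auto simp: second_submodule_def)
  have "\<exists>F. finite F \<and> F \<subseteq> {K. second_submodule K R M} \<and> s \<in> span (\<Union>F)" if s: "s \<in> S" for s
  proof -
    have "s \<in> span (\<Union>{K. second_submodule K R M})" using s S(2) sum by blast
    then show ?thesis using Kc by (intro span_Union_finite) simp_all
  qed
  then obtain F where F: "\<And>s. s \<in> S \<Longrightarrow> finite (F s)"
      "\<And>s. s \<in> S \<Longrightarrow> F s \<subseteq> {K. second_submodule K R M}" "\<And>s. s \<in> S \<Longrightarrow> s \<in> span (\<Union>(F s))"
    by metis
  let ?F = "\<Union>(F ` S)"
  have second: "second_submodule K R M" if "K \<in> ?F" for K using that F(2) by blast
  have "S \<subseteq> span (\<Union>?F)"
  proof
    fix s assume s: "s \<in> S"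
    have "span (\<Union>(F s)) \<subseteq> span (\<Union>?F)" by (rule span_mono) (use s in blast)
    then show "s \<in> span (\<Union>?F)" using F(3)[OF s] by blast
  qed
  moreover have "submodule (span (\<Union>?F)) R M"
    by (rule span_submodule) (use second Kc in blast)
  ultimately have "carrier M \<subseteq> span (\<Union>?F)" using gen by blast
  then show ?thesis using F(1) S(1) second by (intro second_representableI[of ?F]) auto
qed

text \<open>All second submodules with a given annihilator are merged into one, which is second again;
  one summand for each member of \<open>Att_s R M\<close> remains.\<close>

lemma finite_Att_s_second_representable:
  assumes fin: "finite (Att_s R M)"
    and sum: "carrier M \<subseteq> span (\<Union>{K. second_submodule K R M})"
  shows "second_representable R M"
proof -
  let ?F = "\<lambda>p. {K. second_submodule K R M \<and> annihilator R M K = p}"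
  let ?G = "(\<lambda>p. span (\<Union>(?F p))) ` Att_s R M"
  have second: "second_submodule K R M" if K: "K \<in> ?G" for K
  proof -
    obtain p where p: "p \<in> Att_s R M" "K = span (\<Union>(?F p))" using K by (rule imageE) blast
    then have "?F p \<noteq> {}" by (auto simp: Att_s_def)
    then show ?thesis unfolding p(2) by (intro second_submodule_span[where p = p]) auto
  qed
  have "\<Union>{K. second_submodule K R M} \<subseteq> \<Union>?G"
  proof
    fix x assume "x \<in> \<Union>{K. second_submodule K R M}"
    then obtain K where K: "second_submodule K R M" "x \<in> K" by blast
    then have "x \<in> span (\<Union>(?F (annihilator R M K)))"
      using span_superset[of "\<Union>(?F (annihilator R M K))"] by blast
    then show "x \<in> \<Union>?G" using K(1) by (auto simp: Att_s_def)
  qed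
  then have gen: "carrier M \<subseteq> span (\<Union>?G)" using sum span_mono by blast
  show ?thesis by (rule second_representableI[OF finite_imageI[OF fin] _ gen]) (rule second)
qed

end

theorem theorem2p28:
  fixes R :: "('a, 'r) ring_scheme" and M :: "('a, 'b, 'm) module_scheme"
  assumes "Module.module R M" and "carrier M \<noteq> {\<zero>\<^bsub>M\<^esub>}"
  shows "(finitely_generated_module R M \<and> supplemented R M \<and>
           (\<forall>H. maximal_hollow_submodule H R M \<longrightarrow> second_submodule H R M)
             \<longrightarrow> second_representable R M) \<and>
         (coatomic R M \<and>
           (\<forall>N. maximal_submodule N R M \<longrightarrow> (\<exists>L. supplement L N R M)) \<and>
           (\<forall>H. maximal_hollow_submodule H R M \<longrightarrow> second_submodule H R M) \<and>
           finite (Att_s R M)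
             \<longrightarrow> second_representable R M)"
proof -
  interpret module R M by fact
  show ?thesis
  proof (intro conjI impI; elim conjE)
    assume fg: "finitely_generated_module R M" and suppl: "supplemented R M"
      and hollow: "\<forall>H. maximal_hollow_submodule H R M \<longrightarrow> second_submodule H R M"
    have "\<exists>L. supplement L N R M" if "maximal_submodule N R M" for N
      using suppl that by (auto simp: supplemented_def maximal_submodule_def)
    then show "second_representable R M"
      using finitely_generated_second_representable[OF fg]
        coatomic_span_second[OF finitely_generated_coatomic[OF fg]] hollow by blast
  next
    assume "coatomic R M" "\<forall>N. maximal_submodule N R M \<longrightarrow> (\<exists>L. supplement L N R M)"
      "\<forall>H. maximal_hollow_submodule H R M \<longrightarrow> second_submodule H R M" "finite (Att_s R M)"
    then show "second_representable R M"
      using finite_Att_s_second_representable coatomic_span_second by blast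
  qed
qed

end
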